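(* The evaluation action $(Iso(Iso(\mathbb{Z})),Iso(\mathbb{Z}))$ is proper.
   Context: For a metric space $Y$, $Iso(Y)$ is the group of surjective isometries of $Y$ with the topology of pointwise convergence. $\mathbb Z$ carries the discrete metric $d$ ($d(m,n)=0$ if $m=n$, and $1$ otherwise), so $Iso(\mathbb Z)$ is the group of all bijections of $\mathbb Z$. Fix an enumeration $\{z_i\}_{i\ge1}$ of $\mathbb Z$ and equip $Iso(\mathbb Z)$ with the metric $$\varrho(f,g)=\sum_{i=1}^\infty\frac1{3^i}\,d(fz_i,gz_i).$$ $Iso(Iso(\mathbb Z))$ is the group of surjective isometries of $(Iso(\mathbb Z),\varrho)$. "$g_i\to\infty$ in $G$" means that the net $\{g_i\}$ has no convergent subnet in $G$. An action $(G,Y)$ is proper if for every $x\in Y$ there are no $y\in Y$ and nets $\{x_i\}$ in $Y$, $\{g_i\}$ in $G$ with $g_i\to\infty$ in $G$, $x_i\to x$ and $g_ix_i\to y$. *)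

theory Defs
  imports "HOL-Analysis.Analysis" "HOL-Algebra.Group_Action"
begin

section \<open>Nets\<close>

definition directed_set :: "'i set \<Rightarrow> ('i \<Rightarrow> 'i \<Rightarrow> bool) \<Rightarrow> bool" where
  "directed_set I leI \<longleftrightarrow> I \<noteq> {} \<and> reflp_on I leI \<and> transp_on I leI \<and>
     (\<forall>i\<in>I. \<forall>j\<in>I. \<exists>k\<in>I. leI i k \<and> leI j k)"

definition net_limit ::
  "'a topology \<Rightarrow> 'i set \<Rightarrow> ('i \<Rightarrow> 'i \<Rightarrow> bool) \<Rightarrow> ('i \<Rightarrow> 'a) \<Rightarrow> 'a \<Rightarrow> bool" where
  "net_limit T I leI x l \<longleftrightarrow> l \<in> topspace T \<and>
     (\<forall>U. openin T U \<and> l \<in> U \<longrightarrow> (\<exists>i\<in>I. \<forall>j\<in>I. leI i j \<longrightarrow> x j \<in> U))"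

text \<open>\<open>x \<circ> \<phi>\<close>, indexed by \<open>J\<close>, is a subnet of \<open>x\<close>, indexed by \<open>I\<close>.\<close>

definition subnet_map ::
  "'i set \<Rightarrow> ('i \<Rightarrow> 'i \<Rightarrow> bool) \<Rightarrow> 'j set \<Rightarrow> ('j \<Rightarrow> 'j \<Rightarrow> bool) \<Rightarrow> ('j \<Rightarrow> 'i) \<Rightarrow> bool" where
  "subnet_map I leI J leJ \<phi> \<longleftrightarrow> directed_set J leJ \<and> \<phi> \<in> J \<rightarrow> I \<and>
     (\<forall>i\<in>I. \<exists>j\<in>J. \<forall>k\<in>J. leJ j k \<longrightarrow> leI i (\<phi> k))"

text \<open>
  A definition cannot quantify over the types from which subnets draw their indices. The
  index type \<open>'i \<times> 'a set\<close> is large enough: by \<open>no_convergent_subnet_any_type\<close> below, a net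
  without a convergent subnet in the sense of this definition has none over any index type.
\<close>

definition net_to_infinity ::
  "'a topology \<Rightarrow> 'i set \<Rightarrow> ('i \<Rightarrow> 'i \<Rightarrow> bool) \<Rightarrow> ('i \<Rightarrow> 'a) \<Rightarrow> bool" where
  "net_to_infinity T I leI g \<longleftrightarrow>
     \<not> (\<exists>(J :: ('i \<times> 'a set) set) leJ \<phi> l.
          subnet_map I leI J leJ \<phi> \<and> net_limit T J leJ (g \<circ> \<phi>) l)"

lemma no_convergent_subnet_any_type:
  fixes J :: "'j set" and I :: "'i set" and T :: "'a topology"
  assumes inf: "net_to_infinity T I leI g" and I: "directed_set I leI"
    and sub: "subnet_map I leI J leJ \<phi>"
  shows "\<not> net_limit T J leJ (g \<circ> \<phi>) l"
proof
  assume lim: "net_limit T J leJ (g \<circ> \<phi>) l"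
  define K where "K = {(i, U). i \<in> I \<and> openin T U \<and> l \<in> U \<and> g i \<in> U}"
  define leK where "leK = (\<lambda>p q. leI (fst p) (fst q) \<and> snd q \<subseteq> (snd p :: 'a set))"
  have l: "l \<in> topspace T" using lim by (simp add: net_limit_def)
  have trI: "leI i k" if "leI i j" "leI j k" "i \<in> I" "j \<in> I" "k \<in> I" for i j k
    using I that unfolding directed_set_def by (meson transp_onD)
  have rfI: "leI i i" if "i \<in> I" for i
    using I that unfolding directed_set_def by (meson reflp_onD)
  have freq: "\<exists>k\<in>I. leI i k \<and> g k \<in> U" if i: "i \<in> I" and U: "openin T U" "l \<in> U" for i U
  proof -
    obtain j where j: "j \<in> J" "\<forall>k\<in>J. leJ j k \<longrightarrow> leI i (\<phi> k)"
      using sub i unfolding subnet_map_def by blast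
    obtain j' where j': "j' \<in> J" "\<forall>k\<in>J. leJ j' k \<longrightarrow> (g \<circ> \<phi>) k \<in> U"
      using lim U unfolding net_limit_def by blast
    obtain k where "k \<in> J" "leJ j k" "leJ j' k"
      using sub j(1) j'(1) unfolding subnet_map_def directed_set_def by blast
    then show ?thesis using j j' sub unfolding subnet_map_def by auto
  qed
  have K_in: "\<exists>k. (k, U) \<in> K \<and> leI i k" if "i \<in> I" "openin T U" "l \<in> U" for i U
    using freq[OF that] that by (auto simp: K_def)
  have "directed_set K leK"
    unfolding directed_set_def
  proof (intro conjI ballI)
    show "K \<noteq> {}"
      using I K_in[OF _ openin_topspace l] unfolding directed_set_def by blast
    show "reflp_on K leK" by (rule reflp_onI) (auto simp: K_def leK_def rfI)
    show "transp_on K leK"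
    proof (rule transp_onI)
      fix p q r assume "p \<in> K" "q \<in> K" "r \<in> K" "leK p q" "leK q r"
      then show "leK p r"
        using trI[of "fst p" "fst q" "fst r"] by (auto simp: K_def leK_def)
    qed
    fix p q assume pq: "p \<in> K" "q \<in> K"
    then have "openin T (snd p \<inter> snd q)" "l \<in> snd p \<inter> snd q" by (auto simp: K_def)
    moreover obtain i where i: "i \<in> I" "leI (fst p) i" "leI (fst q) i"
      using I pq unfolding directed_set_def by (fastforce simp: K_def)
    ultimately obtain k where k: "(k, snd p \<inter> snd q) \<in> K" "leI i k" using K_in by blast
    then have "leK p (k, snd p \<inter> snd q)" "leK q (k, snd p \<inter> snd q)"
      using pq i trI[of "fst p" i k] trI[of "fst q" i k] by (auto simp: K_def leK_def)
    then show "\<exists>k\<in>K. leK p k \<and> leK q k" using k by blast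
  qed
  moreover have "\<forall>i\<in>I. \<exists>j\<in>K. \<forall>k\<in>K. leK j k \<longrightarrow> leI i (fst k)"
  proof
    fix i assume i: "i \<in> I"
    obtain k where k: "(k, topspace T) \<in> K" "leI i k" using K_in[OF i openin_topspace l] by blast
    have "leI i (fst q)" if q: "q \<in> K" "leK (k, topspace T) q" for q
      by (rule trI[OF k(2)]) (use q k(1) i in \<open>auto simp: K_def leK_def\<close>)
    then show "\<exists>j\<in>K. \<forall>k\<in>K. leK j k \<longrightarrow> leI i (fst k)" using k(1) by blast
  qed
  moreover have "fst \<in> K \<rightarrow> I" by (auto simp: K_def)
  ultimately have "subnet_map I leI K leK fst"
    unfolding subnet_map_def by blast
  moreover have "net_limit T K leK (g \<circ> fst) l"
    unfolding net_limit_def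
  proof (intro conjI allI impI)
    fix U assume U: "openin T U \<and> l \<in> U"
    obtain i where "i \<in> I" using I unfolding directed_set_def by blast
    then obtain k where "(k, U) \<in> K" using K_in U by blast
    moreover have "\<forall>q\<in>K. leK (k, U) q \<longrightarrow> (g \<circ> fst) q \<in> U" by (auto simp: K_def leK_def)
    ultimately show "\<exists>i\<in>K. \<forall>j\<in>K. leK i j \<longrightarrow> (g \<circ> fst) j \<in> U" by blast
  qed (rule l)
  ultimately show False using inf unfolding net_to_infinity_def by blast
qed


section \<open>Proper actions\<close>

text \<open>
  The argument of type \<open>'i itself\<close> only names the type from which the nets in the definition draw
  their indices; a statement in which \<open>'i\<close> is a free type variable is about arbitrary nets.
\<close>

definition proper_action ::
  "'i itself \<Rightarrow> ('g, 'm) monoid_scheme \<Rightarrow> 'g topology \<Rightarrow> 'y topology \<Rightarrow> ('g \<Rightarrow> 'y \<Rightarrow> 'y) \<Rightarrow> bool" where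
  "proper_action _ G TG TY act \<longleftrightarrow>
     group_action G (topspace TY) act \<and>
     (\<forall>x\<in>topspace TY.
        \<not> (\<exists>y\<in>topspace TY. \<exists>(I :: 'i set) leI xs gs.
             directed_set I leI \<and> xs \<in> I \<rightarrow> topspace TY \<and> gs \<in> I \<rightarrow> carrier G \<and>
             net_to_infinity TG I leI gs \<and>
             net_limit TY I leI xs x \<and>
             net_limit TY I leI (\<lambda>i. act (gs i) (xs i)) y))"


section \<open>Isometry groups of metric spaces\<close>

definition isometries :: "'a set \<Rightarrow> ('a \<Rightarrow> 'a \<Rightarrow> real) \<Rightarrow> ('a \<Rightarrow> 'a) set" where
  "isometries M d = {f \<in> Bij M. \<forall>x\<in>M. \<forall>y\<in>M. d (f x) (f y) = d x y}"

definition iso_group :: "'a set \<Rightarrow> ('a \<Rightarrow> 'a \<Rightarrow> real) \<Rightarrow> ('a \<Rightarrow> 'a) monoid" where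
  "iso_group M d = (BijGroup M)\<lparr>carrier := isometries M d\<rparr>"

text \<open>The topology of pointwise convergence; elements of \<open>Bij M\<close> are extensional, so they are
  points of the product over \<open>M\<close>.\<close>

definition iso_topology :: "'a set \<Rightarrow> ('a \<Rightarrow> 'a \<Rightarrow> real) \<Rightarrow> ('a \<Rightarrow> 'a) topology" where
  "iso_topology M d =
     subtopology (product_topology (\<lambda>_. Metric_space.mtopology M d) M) (isometries M d)"

lemma subgroup_isometries: "subgroup (isometries M d) (BijGroup M)"
proof (rule group.subgroupI[OF group_BijGroup])
  show "isometries M d \<subseteq> carrier (BijGroup M)"
    by (auto simp: isometries_def BijGroup_def)
  show "isometries M d \<noteq> {}"
  proof -
    have "(\<lambda>x\<in>M. x) \<in> isometries M d"
      using id_Bij[of M] by (simp add: isometries_def)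
    then show ?thesis by blast
  qed
next
  fix f assume f: "f \<in> isometries M d"
  then have B: "f \<in> Bij M" by (simp add: isometries_def)
  have "d (inv_into M f x) (inv_into M f y) = d x y" if "x \<in> M" "y \<in> M" for x y
  proof -
    have "f ` M = M" using B by (simp add: Bij_def bij_betw_def)
    then have inv: "inv_into M f x \<in> M" "inv_into M f y \<in> M"
      "f (inv_into M f x) = x" "f (inv_into M f y) = y"
      using that by (simp_all add: inv_into_into f_inv_into_f)
    have "\<forall>a\<in>M. \<forall>b\<in>M. d (f a) (f b) = d a b"
      using f by (simp add: isometries_def)
    from bspec[OF bspec[OF this inv(1)] inv(2)] show ?thesis by (simp only: inv(3,4))
  qed
  then show "inv\<^bsub>BijGroup M\<^esub> f \<in> isometries M d"
    using restrict_inv_into_Bij[OF B] by (simp add: inv_BijGroup[OF B] isometries_def)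
next
  fix f g assume fg: "f \<in> isometries M d" "g \<in> isometries M d"
  then have B: "f \<in> Bij M" "g \<in> Bij M" by (auto simp: isometries_def)
  have "d (compose M f g x) (compose M f g y) = d x y" if "x \<in> M" "y \<in> M" for x y
  proof -
    have "g x \<in> M" "g y \<in> M" using that Bij_imp_funcset[OF B(2)] by auto
    then show ?thesis using fg that by (simp add: isometries_def compose_def)
  qed
  then show "f \<otimes>\<^bsub>BijGroup M\<^esub> g \<in> isometries M d"
    using B compose_Bij[OF B] by (simp add: BijGroup_def isometries_def)
qed

lemma group_action_evaluation: "group_action (iso_group M d) M (\<lambda>g x. g x)"
proof -
  interpret B: group "BijGroup M" by (rule group_BijGroup)
  have "group (iso_group M d)"
    unfolding iso_group_def by (rule B.subgroup_imp_group[OF subgroup_isometries])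
  moreover have "(\<lambda>g x. g x) \<in> hom (iso_group M d) (BijGroup M)"
    by (auto simp: hom_def iso_group_def isometries_def BijGroup_def)
  ultimately show ?thesis
    by (simp add: group_action_def group_hom_def group_hom_axioms_def B.is_group)
qed


section \<open>The integers with the discrete metric\<close>

definition IsoZ :: "(int \<Rightarrow> int) set" where
  "IsoZ = isometries UNIV discrete_metric.dd"

text \<open>The enumeration starts at \<open>z 1\<close>, hence the shift of the summation index.\<close>

definition rho :: "(nat \<Rightarrow> int) \<Rightarrow> (int \<Rightarrow> int) \<Rightarrow> (int \<Rightarrow> int) \<Rightarrow> real" where
  "rho z f g = (\<Sum>n. 1 / 3 ^ Suc n * discrete_metric.dd (f (z (Suc n))) (g (z (Suc n))))"

lemma IsoZ_eq: "IsoZ = {f. bij f}"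
proof -
  have "discrete_metric.dd (f x) (f y) = discrete_metric.dd x y" if "bij f"
    for f :: "int \<Rightarrow> int" and x y
    using bij_is_inj[OF that] by (simp add: discrete_metric.dd_def inj_eq)
  then show ?thesis by (auto simp: IsoZ_def isometries_def Bij_def)
qed

lemma summable_rho:
  "summable (\<lambda>n. 1 / 3 ^ Suc n * discrete_metric.dd (f (z (Suc n))) (g (z (Suc n))))"
proof (rule summable_comparison_test')
  show "summable (\<lambda>n. (1/3::real) ^ n)" by (rule summable_geometric) simp
  show "norm (1 / 3 ^ Suc n * discrete_metric.dd (f (z (Suc n))) (g (z (Suc n))))
      \<le> (1/3::real) ^ n" for n
    by (simp add: discrete_metric.dd_def field_simps)
qed

lemma Metric_space_rho:
  assumes z: "bij_betw z {1..} UNIV"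
  shows "Metric_space IsoZ (rho z)"
proof
  fix f g h :: "int \<Rightarrow> int"
  show "0 \<le> rho z f g"
    unfolding rho_def
    by (rule suminf_nonneg[OF summable_rho]) (simp add: discrete_metric.dd_def)
  show "rho z f g = rho z g f"
    by (simp add: rho_def discrete_metric.dd_def eq_commute[of "f _"])
  show "rho z f h \<le> rho z f g + rho z g h"
    unfolding rho_def suminf_add[OF summable_rho summable_rho]
    by (rule suminf_le[OF _ summable_rho summable_add[OF summable_rho summable_rho]])
      (simp add: discrete_metric.dd_def)
  show "rho z f g = 0 \<longleftrightarrow> f = g"
  proof
    assume "rho z f g = 0"
    then have eq: "\<forall>n. f (z (Suc n)) = g (z (Suc n))"
      unfolding rho_def
      by (subst (asm) suminf_eq_zero_iff[OF summable_rho])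
        (auto simp: discrete_metric.dd_def split: if_splits)
    show "f = g"
    proof
      fix a
      obtain m where "m \<ge> 1" "a = z m"
        using z by (metis UNIV_I atLeast_iff bij_betw_iff_bijections)
      then show "f a = g a" using eq by (cases m) auto
    qed
  qed (simp add: rho_def discrete_metric.dd_def)
qed

end

theory Submission
  imports Defs
begin

text \<open>
  Ternary expansions with digits 0 and 1 are unique, so \<open>rho z f g\<close> determines the set of points
  where \<open>f\<close> and \<open>g\<close> agree, and every isometry \<open>\<phi>\<close> of \<open>IsoZ\<close> preserves this set. Together with
  surjectivity of \<open>\<phi>\<close> this forces \<open>\<phi>\<close> to be the left translation by \<open>\<phi> id\<close>. If \<open>x\<^sub>i \<longlongrightarrow> x\<close> and
  \<open>\<sigma>\<^sub>i \<circ> x\<^sub>i \<longlongrightarrow> y\<close>, then at each point \<open>\<sigma>\<^sub>i\<close> eventually agrees with \<open>y \<circ> x\<^sup>-\<^sup>1\<close>, so the translations by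
  \<open>\<sigma>\<^sub>i\<close> converge to the translation by \<open>y \<circ> x\<^sup>-\<^sup>1\<close>: the net of group elements itself converges.
\<close>

section \<open>Nets and filters\<close>

text \<open>Generated by the tails of the net, so that \<open>eventually\<close> and
  \<open>limitin\<close> become available for nets.\<close>

definition net_filter :: "'i set \<Rightarrow> ('i \<Rightarrow> 'i \<Rightarrow> bool) \<Rightarrow> 'i filter" where
  "net_filter I leI = (INF i\<in>I. principal {j \<in> I. leI i j})"

text \<open>Directedness and transitivity put a tail inside the intersection of any two tails; the
  tails thus form a filter base.\<close>

lemma eventually_net_filter:
  assumes "directed_set I leI"
  shows "eventually P (net_filter I leI) \<longleftrightarrow> (\<exists>i\<in>I. \<forall>j\<in>I. leI i j \<longrightarrow> P j)"
proof -
  have "\<exists>k\<in>I. principal {l \<in> I. leI k l} \<le> inf (principal {l \<in> I. leI i l}) (principal {l \<in> I. leI j l})"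
    if ij: "i \<in> I" "j \<in> I" for i j
  proof -
    obtain k where "k \<in> I" "leI i k" "leI j k"
      using assms ij unfolding directed_set_def by blast
    moreover have "transp_on I leI" using assms by (simp add: directed_set_def)
    ultimately have "{l \<in> I. leI k l} \<subseteq> {l \<in> I. leI i l} \<inter> {l \<in> I. leI j l}"
      using ij unfolding transp_on_def by blast
    then show ?thesis using \<open>k \<in> I\<close> by (metis inf_principal principal_le_iff)
  qed
  moreover have "I \<noteq> {}" using assms by (simp add: directed_set_def)
  ultimately have "eventually P (net_filter I leI) \<longleftrightarrow>
      (\<exists>i\<in>I. eventually P (principal {j \<in> I. leI i j}))"
    unfolding net_filter_def by (intro eventually_INF_base)
  then show ?thesis by (auto simp: eventually_principal)
qed

lemma net_limit_iff_limitin: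
  assumes "directed_set I leI"
  shows "net_limit T I leI x l \<longleftrightarrow> limitin T x l (net_filter I leI)"
  by (simp add: net_limit_def limitin_def eventually_net_filter[OF assms])

lemma eventually_net_filter_mem:
  assumes "directed_set I leI"
  shows "\<forall>\<^sub>F i in net_filter I leI. i \<in> I"
  using assms unfolding eventually_net_filter[OF assms] directed_set_def by blast

lemma subnet_map_id:
  assumes "directed_set I leI"
  shows "subnet_map I leI I leI id"
  using assms by (auto simp: subnet_map_def directed_set_def)

text \<open>A net is a subnet of itself. Its index type differs from the one fixed in
  \<open>net_to_infinity\<close>, so the version for arbitrary index types is applied.\<close>

lemma net_to_infinity_not_limit:
  assumes "directed_set I leI" "net_to_infinity T I leI g"
  shows "\<not> net_limit T I leI g l"
  using no_convergent_subnet_any_type[OF assms(2,1) subnet_map_id[OF assms(1)]] by simp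

section \<open>The metric on the permutation group of the integers\<close>

lemma sums_ternary_tail: "(\<lambda>n. 1 / 3 ^ Suc (n + N) :: real) sums (1 / (2 * 3 ^ N))"
proof -
  have "(\<lambda>n. (1 / 3 ^ Suc N) * (1 / 3 :: real) ^ n) sums ((1 / 3 ^ Suc N) * (1 / (1 - 1 / 3)))"
    by (intro sums_mult geometric_sums) simp
  then show ?thesis by (simp add: power_add power_one_over field_simps)
qed

text \<open>Once the earlier digits vanish, term \<open>N\<close> is minus the tail after it. In
  base 3 that tail is at most half of \<open>1 / 3 ^ Suc N\<close>, so the digit has absolute value
  at most 1/2.\<close>

lemma ternary_digits_zero:
  fixes d :: "nat \<Rightarrow> real"
  assumes d: "\<And>n. d n \<in> {-1, 0, 1}"
    and 0: "(\<Sum>n. 1 / 3 ^ Suc n * d n) = 0"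
  shows "d n = 0"
proof (induction n rule: less_induct)
  case (less N)
  let ?t = "\<lambda>n. 1 / 3 ^ Suc n * d n"
  have abs_d: "\<bar>d n\<bar> \<le> 1" for n using d[of n] by auto
  have bound: "\<bar>?t n\<bar> \<le> 1 / 3 ^ Suc n" for n
    using abs_d[of n] by (simp add: abs_mult field_simps)
  have summ: "summable ?t"
    by (rule summable_comparison_test'[OF sums_summable[OF sums_ternary_tail[of 0]]])
      (use bound in simp)
  have "(\<Sum>n. ?t n) = (\<Sum>n. ?t (n + Suc N)) + (\<Sum>n<Suc N. ?t n)"
    by (rule suminf_split_initial_segment[OF summ])
  moreover have "(\<Sum>n<Suc N. ?t n) = ?t N" using less by simp
  ultimately have eq: "?t N = - (\<Sum>n. ?t (n + Suc N))" using 0 by simp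
  have "norm (\<Sum>n. ?t (n + Suc N)) \<le> (\<Sum>n. 1 / 3 ^ Suc (n + Suc N))"
  proof (rule norm_suminf_le)
    show "norm (?t (n + Suc N)) \<le> 1 / 3 ^ Suc (n + Suc N)" for n
      using bound[of "n + Suc N"] by simp
  qed (rule sums_summable[OF sums_ternary_tail])
  then have "\<bar>\<Sum>n. ?t (n + Suc N)\<bar> \<le> 1 / (2 * 3 ^ Suc N)"
    using sums_unique[OF sums_ternary_tail[of "Suc N"]] by (simp only: real_norm_def)
  then have "\<bar>?t N\<bar> \<le> 1 / (2 * 3 ^ Suc N)" using eq by linarith
  then have "\<bar>d N\<bar> \<le> 1 / 2" by (simp add: abs_mult field_simps)
  then show "d N = 0" using d[of N] by auto
qed

lemma ex_index:
  assumes "bij_betw z {1..} (UNIV :: 'a set)"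
  shows "\<exists>n. a = z (Suc n)"
proof -
  have "a \<in> z ` {1..}" using bij_betw_imp_surj_on[OF assms] by simp
  then obtain m where "a = z m" "m \<ge> (1 :: nat)" by auto
  then show ?thesis by (cases m) auto
qed

text \<open>Subtracting the two series leaves digits in {-1, 0, 1} with sum zero, so they all
  vanish; \<open>z\<close> reaches every integer.\<close>

lemma rho_eq_imp_agree_iff:
  assumes z: "bij_betw z {1..} UNIV" and eq: "rho z f g = rho z f' g'"
  shows "f a = g a \<longleftrightarrow> f' a = g' a"
proof -
  define d where "d n = discrete_metric.dd (f (z (Suc n))) (g (z (Suc n)))
    - discrete_metric.dd (f' (z (Suc n))) (g' (z (Suc n)))" for n
  have "(\<Sum>n. 1 / 3 ^ Suc n * d n) = rho z f g - rho z f' g'"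
    unfolding rho_def d_def suminf_diff[OF summable_rho summable_rho] right_diff_distrib ..
  then have "(\<Sum>n. 1 / 3 ^ Suc n * d n) = 0" using eq by (simp only: diff_self)
  moreover have "d n \<in> {-1, 0, 1}" for n by (simp add: d_def discrete_metric.dd_def)
  ultimately have "d n = 0" for n by (rule ternary_digits_zero[rotated])
  moreover obtain n where "a = z (Suc n)"
    using ex_index[OF z] by blast
  ultimately have "discrete_metric.dd (f a) (g a) = discrete_metric.dd (f' a) (g' a)"
    unfolding d_def by (metis eq_iff_diff_eq_0)
  then show ?thesis by (simp add: discrete_metric.dd_def split: if_splits)
qed

lemma rho_less_imp_agree:
  assumes "rho z f g < 1 / 3 ^ Suc n"
  shows "f (z (Suc n)) = g (z (Suc n))"
proof (rule ccontr)
  assume "f (z (Suc n)) \<noteq> g (z (Suc n))"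
  then have "1 / 3 ^ Suc n \<le> rho z f g"
    using sum_le_suminf[OF summable_rho[of f z g], of "{n}"]
    by (simp add: rho_def discrete_metric.dd_def)
  then show False using assms by simp
qed

lemma rho_le_if_agree:
  assumes "\<And>n. n < N \<Longrightarrow> f (z (Suc n)) = g (z (Suc n))"
  shows "rho z f g \<le> 1 / (2 * 3 ^ N)"
proof -
  let ?t = "\<lambda>n. 1 / 3 ^ Suc n * discrete_metric.dd (f (z (Suc n))) (g (z (Suc n)))"
  have "rho z f g = (\<Sum>n. ?t (n + N)) + (\<Sum>n<N. ?t n)"
    unfolding rho_def by (rule suminf_split_initial_segment[OF summable_rho])
  also have "(\<Sum>n<N. ?t n) = 0" using assms by (simp add: discrete_metric.dd_def)
  also have "(\<Sum>n. ?t (n + N)) \<le> (\<Sum>n. 1 / 3 ^ Suc (n + N))"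
    by (intro suminf_le summable_ignore_initial_segment[OF summable_rho]
        sums_summable[OF sums_ternary_tail]) (simp add: discrete_metric.dd_def)
  also have "\<dots> = 1 / (2 * 3 ^ N)" using sums_unique[OF sums_ternary_tail] by simp
  finally show ?thesis by simp
qed

text \<open>A disagreement at \<open>z (Suc n)\<close> alone costs \<open>1 / 3 ^ Suc n\<close>,
  while agreement at the first \<open>N\<close> points leaves only a small tail. Hence
  \<open>rho z\<close> induces pointwise convergence, which for discrete values means eventual
  equality.\<close>

lemma limitin_rho_iff:
  assumes z: "bij_betw z {1..} UNIV"
  shows "limitin (Metric_space.mtopology IsoZ (rho z)) x l F \<longleftrightarrow>
    l \<in> IsoZ \<and> (\<forall>\<^sub>F i in F. x i \<in> IsoZ) \<and> (\<forall>a. \<forall>\<^sub>F i in F. x i a = l a)"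
    (is "?L \<longleftrightarrow> ?R")
proof -
  interpret Metric_space IsoZ "rho z" by (rule Metric_space_rho[OF z])
  show ?thesis
  proof
    assume L: ?L
    have *: "\<forall>\<^sub>F i in F. x i \<in> IsoZ \<and> rho z (x i) l < e" if "e > 0" for e
      using L that by (simp add: limitin_metric)
    have "\<forall>\<^sub>F i in F. x i a = l a" for a
    proof -
      obtain n where "a = z (Suc n)"
        using ex_index[OF z] by blast
      then show ?thesis
        using *[of "1 / 3 ^ Suc n"] by (auto elim!: eventually_mono intro: rho_less_imp_agree)
    qed
    moreover have "\<forall>\<^sub>F i in F. x i \<in> IsoZ"
      using *[of 1] by (auto elim: eventually_mono)
    ultimately show ?R using L by (simp add: limitin_metric)
  next
    assume R: ?R
    have "\<forall>\<^sub>F i in F. x i \<in> IsoZ \<and> rho z (x i) l < e" if e: "e > 0" for e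
    proof -
      obtain N where N: "(1 / 3 :: real) ^ N < e"
        using real_arch_pow_inv[OF e, of "1 / 3"] by auto
      have "\<forall>\<^sub>F i in F. \<forall>n\<in>{..<N}. x i (z (Suc n)) = l (z (Suc n))"
        using R by (intro eventually_ball_finite) auto
      moreover have "\<forall>\<^sub>F i in F. x i \<in> IsoZ" using R by simp
      ultimately show ?thesis
      proof eventually_elim
        case (elim i)
        have "rho z (x i) l \<le> 1 / (2 * 3 ^ N)" using elim(1) by (intro rho_le_if_agree) auto
        also have "\<dots> \<le> (1 / 3) ^ N" by (simp add: power_one_over field_simps)
        finally show ?case using N elim(2) by simp
      qed
    qed
    then show ?L using R by (simp add: limitin_metric)
  qed
qed

section \<open>Isometries are left translations\<close>

text \<open>The transposition of \<open>d\<close> and \<open>h m\<close> moves \<open>h m\<close> to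
  \<open>d\<close> and fixes \<open>h n\<close>, which differs from both.\<close>

lemma ex_bij_two_values:
  fixes h :: "'a \<Rightarrow> 'a"
  assumes "bij h" "m \<noteq> n" "d \<noteq> h n"
  shows "\<exists>k. bij k \<and> k n = h n \<and> k m = d"
proof (intro exI conjI)
  show "bij (Transposition.transpose d (h m) \<circ> h)" using assms by (intro bij_comp bij_transpose)
  show "(Transposition.transpose d (h m) \<circ> h) n = h n"
    using assms bij_is_inj[OF assms(1)] by (auto simp: Transposition.transpose_def inj_eq)
qed simp

lemma isometry_eq_translation:
  assumes z: "bij_betw z {1..} UNIV"
    and \<phi>: "\<phi> \<in> isometries IsoZ (rho z)" and f: "f \<in> IsoZ"
  shows "\<phi> f = \<phi> id \<circ> f"
proof
  fix n
  have bij: "bij_betw \<phi> IsoZ IsoZ" using \<phi> by (simp add: isometries_def Bij_def)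
  have mem: "\<phi> h \<in> IsoZ" if "h \<in> IsoZ" for h using bij that by (rule bij_betwE[rule_format])
  have agree: "\<phi> g a = \<phi> h a \<longleftrightarrow> g a = h a" if "g \<in> IsoZ" "h \<in> IsoZ" for g h a
    by (rule rho_eq_imp_agree_iff[OF z]) (use \<phi> that in \<open>auto simp: isometries_def\<close>)
  have id: "id \<in> IsoZ" by (simp add: IsoZ_eq)
  show "\<phi> f n = (\<phi> id \<circ> f) n"
  proof (cases "f n = n")
    case True
    then show ?thesis using agree[OF f id, of n] by simp
  next
    case False
    show ?thesis
    proof (rule ccontr)
      \<comment> \<open>The two values are distinct, so some permutation \<open>k\<close> agrees
        with \<open>\<phi> f\<close> at \<open>n\<close> and with \<open>\<phi> id\<close> at
        \<open>f n\<close>. By surjectivity \<open>k = \<phi> h\<close>; then \<open>h\<close>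
        agrees with \<open>f\<close> at \<open>n\<close> and with \<open>id\<close> at
        \<open>f n\<close>, taking the value \<open>f n\<close> twice.\<close>
      assume "\<phi> f n \<noteq> (\<phi> id \<circ> f) n"
      then obtain k where k: "bij k" "k n = \<phi> f n" "k (f n) = \<phi> id (f n)"
        using ex_bij_two_values[of "\<phi> f" "f n" n "\<phi> id (f n)"] mem[OF f] False
        by (auto simp: IsoZ_eq)
      then have "k \<in> \<phi> ` IsoZ" using bij by (simp add: bij_betw_def IsoZ_eq)
      then obtain h where h: "h \<in> IsoZ" "k = \<phi> h" by blast
      have "h n = f n" "h (f n) = f n"
        using k h agree[OF h(1) f, of n] agree[OF h(1) id, of "f n"] by auto
      then show False using False h(1) 
        by (metis IsoZ_eq bij_is_inj injD mem_Collect_eq)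
    qed
  qed
qed

text \<open>Injectivity of \<open>\<tau>\<close> preserves agreement at each point, and translation
  by the inverse undoes the map. The restriction to \<open>IsoZ\<close> supplies the extensionality
  demanded by \<open>Bij\<close>.\<close>

lemma translation_isometry:
  assumes "bij \<tau>"
  shows "(\<lambda>f\<in>IsoZ. \<tau> \<circ> f) \<in> isometries IsoZ (rho z)"
proof -
  let ?\<tau>' = "inv_into UNIV \<tau>"
  have inv: "?\<tau>' \<circ> \<tau> = id" "\<tau> \<circ> ?\<tau>' = id"
    using bij_is_inj[OF assms] bij_is_surj[OF assms] by (simp_all flip: inj_iff surj_iff)
  have "bij_betw (\<lambda>f. \<tau> \<circ> f) IsoZ IsoZ"
  proof (rule bij_betwI[where g = "\<lambda>f. ?\<tau>' \<circ> f"])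
    show "(\<lambda>f. \<tau> \<circ> f) \<in> IsoZ \<rightarrow> IsoZ"
      unfolding IsoZ_eq using bij_comp[OF _ assms] by blast
    show "(\<lambda>f. ?\<tau>' \<circ> f) \<in> IsoZ \<rightarrow> IsoZ"
      unfolding IsoZ_eq using bij_comp[OF _ bij_imp_bij_inv[OF assms]] by blast
    show "?\<tau>' \<circ> (\<tau> \<circ> f) = f" "\<tau> \<circ> (?\<tau>' \<circ> f) = f" for f
      by (simp_all only: o_assoc inv id_o)
  qed
  moreover have "rho z (\<tau> \<circ> f) (\<tau> \<circ> g) = rho z f g" for f g
    using bij_is_inj[OF assms] by (simp add: rho_def discrete_metric.dd_def inj_eq)
  moreover have "bij_betw (\<lambda>f\<in>IsoZ. \<tau> \<circ> f) IsoZ IsoZ \<longleftrightarrow> bij_betw (\<lambda>f. \<tau> \<circ> f) IsoZ IsoZ"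
    by (rule bij_betw_cong) simp
  ultimately show ?thesis by (simp add: isometries_def Bij_def)
qed

section \<open>Properness of the evaluation action\<close>

theorem proposition6p6:
  fixes z :: "nat \<Rightarrow> int"
  assumes "bij_betw z {1..} UNIV"
  shows "proper_action TYPE('i)
    (iso_group IsoZ (rho z)) (iso_topology IsoZ (rho z))
    (Metric_space.mtopology IsoZ (rho z)) (\<lambda>g x. g x)"
proof -
  interpret Metric_space IsoZ "rho z" by (rule Metric_space_rho[OF assms])
  have False if dir: "directed_set I leI"
    and gs: "gs \<in> I \<rightarrow> isometries IsoZ (rho z)"
    and inf: "net_to_infinity (iso_topology IsoZ (rho z)) I leI gs"
    and x: "net_limit mtopology I leI xs x"
    and y: "net_limit mtopology I leI (\<lambda>i. gs i (xs i)) y"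
    for I :: "'i set" and leI gs xs x y
  proof -
    let ?F = "net_filter I leI"
    note lim = net_limit_iff_limitin[OF dir] limitin_rho_iff[OF assms]
    have xL: "bij x" "\<forall>\<^sub>F i in ?F. xs i \<in> IsoZ" "\<And>a. \<forall>\<^sub>F i in ?F. xs i a = x a"
      using x unfolding lim by (auto simp: IsoZ_eq)
    have yL: "bij y" "\<And>a. \<forall>\<^sub>F i in ?F. gs i (xs i) a = y a"
      using y unfolding lim by (auto simp: IsoZ_eq)
    define \<tau> where "\<tau> = y \<circ> inv_into UNIV x"
    define L where "L = (\<lambda>f\<in>IsoZ. \<tau> \<circ> f)"
    have \<tau>: "bij \<tau>" unfolding \<tau>_def by (intro bij_comp bij_imp_bij_inv xL yL)
    have L: "L \<in> isometries IsoZ (rho z)" unfolding L_def by (rule translation_isometry[OF \<tau>])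
    have gs_ev: "\<forall>\<^sub>F i in ?F. gs i \<in> isometries IsoZ (rho z)"
      using eventually_net_filter_mem[OF dir] gs by (auto elim: eventually_mono)
    \<comment> \<open>At the preimage of \<open>b\<close> under \<open>x\<close>, eventually
      \<open>xs i\<close> takes the value \<open>b\<close>, which \<open>gs i id\<close> must then
      send to the value of \<open>y\<close> there, namely \<open>\<tau> b\<close>.\<close>
    have ev: "\<forall>\<^sub>F i in ?F. gs i id b = \<tau> b" for b
      using xL(2) xL(3)[of "inv_into UNIV x b"] yL(2)[of "inv_into UNIV x b"] gs_ev
    proof eventually_elim
      case (elim i)
      have "gs i (xs i) (inv_into UNIV x b) = gs i id (xs i (inv_into UNIV x b))"
        using isometry_eq_translation[OF assms elim(4,1)] by simp
      then show ?case
        using elim(2,3) bij_is_surj[OF xL(1)] by (simp add: \<tau>_def surj_f_inv_f)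
    qed
    have "limitin mtopology (\<lambda>i. gs i f) (L f) ?F" if f: "f \<in> IsoZ" for f
      unfolding limitin_rho_iff[OF assms]
    proof (intro conjI allI)
      show "L f \<in> IsoZ" using f \<tau> by (simp add: L_def IsoZ_eq bij_comp)
      show "\<forall>\<^sub>F i in ?F. gs i f \<in> IsoZ"
        using gs_ev by eventually_elim (use f in \<open>auto simp: isometries_def Bij_def bij_betw_def\<close>)
      show "\<forall>\<^sub>F i in ?F. gs i f a = L f a" for a
        using gs_ev ev[of "f a"]
        by eventually_elim (use f isometry_eq_translation[OF assms _ f] in \<open>simp add: L_def\<close>)
    qed
    \<comment> \<open>Componentwise convergence in the product topology also requires the net to be
      eventually extensional.\<close>
    moreover have "\<forall>\<^sub>F i in ?F. gs i \<in> IsoZ \<rightarrow>\<^sub>E IsoZ"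
      using gs_ev by eventually_elim (auto simp: isometries_def Bij_def bij_betw_def PiE_def)
    moreover have "L \<in> extensional IsoZ" by (simp add: L_def)
    ultimately have "limitin (iso_topology IsoZ (rho z)) gs L ?F"
      using L gs_ev
      by (simp add: iso_topology_def limitin_subtopology limitin_componentwise)
    then show False
      using net_to_infinity_not_limit[OF dir inf] by (simp add: net_limit_iff_limitin[OF dir])
  qed
  moreover have "carrier (iso_group IsoZ (rho z)) = isometries IsoZ (rho z)"
    by (simp add: iso_group_def)
  ultimately show ?thesis
    unfolding proper_action_def using group_action_evaluation[of IsoZ "rho z"]
    by (simp only: topspace_mtopology) blast
qed

end
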